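(* Let $X$ be a reflexive locally convex Hausdorff space and $T:X\to X$ a continuous, linear operator. Then the following statements are equivalent: (i) $T$ is mean ergodic; (ii) $T$ is $M_p$-ergodic for some $p>-1$; (iii) $T$ is $M_p$-ergodic for all $p>-1$.
   Context: Spaces are over $\mathbb{C}$; an operator on $X$ is a continuous linear map $X\to X$; $T^0=\mathrm{Id}$. A reflexive space is a barrelled, semi-reflexive locally convex Hausdorff space. $T$ is mean ergodic if the sequence of Cesàro means $T_{[n]}=\frac1{n+1}\sum_{k=0}^nT^k$ converges pointwise on $X$ to some operator on $X$. For $p\in\mathbb{R}$ and $n\ge1$ let $S(n,p)=\sum_{i=1}^n i^p$, and let $M_p$ be the infinite lower triangular matrix (rows and columns indexed from $1$) with entries $i^p/S(n,p)$ for $1\le i\le n$ and $0$ for $i>n$. Column $i$ is applied to $T^{i-1}$, so $(M_pT)_n=\frac1{S(n,p)}\sum_{k=1}^n k^pT^{k-1}$ for $n\ge1$. $T$ is $M_p$-ergodic if there is an operator $P$ on $X$ such that $(M_pT)_nx\to Px$ for every $x\in X$. *)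

theory Defs
  imports "HOL-Analysis.Analysis"
begin

text \<open>
  A complex vector space is given by a scalar multiplication \<open>smul\<close> on a type of additive
  topological groups; the topology is the one of the type class.
\<close>

definition convex_set :: "(complex \<Rightarrow> 'a::ab_group_add \<Rightarrow> 'a) \<Rightarrow> 'a set \<Rightarrow> bool" where
  "convex_set smul A \<longleftrightarrow>
     (\<forall>x\<in>A. \<forall>y\<in>A. \<forall>u v :: real. u \<ge> 0 \<longrightarrow> v \<ge> 0 \<longrightarrow> u + v = 1 \<longrightarrow>
        smul (of_real u) x + smul (of_real v) y \<in> A)"

definition balanced_set :: "(complex \<Rightarrow> 'a \<Rightarrow> 'a) \<Rightarrow> 'a set \<Rightarrow> bool" where
  "balanced_set smul A \<longleftrightarrow> (\<forall>c. norm c \<le> 1 \<longrightarrow> smul c ` A \<subseteq> A)"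

definition absorbs :: "(complex \<Rightarrow> 'a \<Rightarrow> 'a) \<Rightarrow> 'a set \<Rightarrow> 'a set \<Rightarrow> bool" where
  "absorbs smul A B \<longleftrightarrow> (\<exists>r>0. \<forall>c. norm c \<ge> r \<longrightarrow> B \<subseteq> smul c ` A)"

definition absorbing_set :: "(complex \<Rightarrow> 'a \<Rightarrow> 'a) \<Rightarrow> 'a set \<Rightarrow> bool" where
  "absorbing_set smul A \<longleftrightarrow> (\<forall>x. absorbs smul A {x})"

definition bounded_set ::
    "(complex \<Rightarrow> 'a::{topological_space, zero} \<Rightarrow> 'a) \<Rightarrow> 'a set \<Rightarrow> bool" where
  "bounded_set smul B \<longleftrightarrow> (\<forall>U. 0 \<in> interior U \<longrightarrow> absorbs smul U B)"

locale locally_convex_hausdorff = vector_space smul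
  for smul :: "complex \<Rightarrow> 'a::{topological_ab_group_add, t2_space} \<Rightarrow> 'a" +
  assumes continuous_scale: "continuous_on UNIV (\<lambda>(c, x). smul c x)"
    and locally_convex:
      "0 \<in> interior U \<Longrightarrow> \<exists>V\<subseteq>U. 0 \<in> interior V \<and> convex_set smul V"

definition barrel ::
    "(complex \<Rightarrow> 'a::{topological_space, ab_group_add} \<Rightarrow> 'a) \<Rightarrow> 'a set \<Rightarrow> bool" where
  "barrel smul A \<longleftrightarrow>
     closed A \<and> convex_set smul A \<and> balanced_set smul A \<and> absorbing_set smul A"

definition barrelled ::
    "(complex \<Rightarrow> 'a::{topological_space, ab_group_add} \<Rightarrow> 'a) \<Rightarrow> bool" where
  "barrelled smul \<longleftrightarrow> (\<forall>A. barrel smul A \<longrightarrow> 0 \<in> interior A)"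

definition dual ::
    "(complex \<Rightarrow> 'a::{topological_space, ab_group_add} \<Rightarrow> 'a) \<Rightarrow> ('a \<Rightarrow> complex) set" where
  "dual smul = {f. Vector_Spaces.linear smul (*) f \<and> continuous_on UNIV f}"

text \<open>The topology on the dual of uniform convergence on bounded sets.\<close>

definition strong_dual ::
    "(complex \<Rightarrow> 'a::{topological_space, ab_group_add} \<Rightarrow> 'a) \<Rightarrow> ('a \<Rightarrow> complex) topology" where
  "strong_dual smul = topology (\<lambda>W. W \<subseteq> dual smul \<and>
     (\<forall>f\<in>W. \<exists>B. bounded_set smul B \<and>
        (\<exists>e>0. \<forall>g\<in>dual smul. (\<forall>x\<in>B. norm (g x - f x) \<le> e) \<longrightarrow> g \<in> W)))"

lemma bounded_set_Un:
  fixes smul :: "complex \<Rightarrow> 'a::{topological_space, zero} \<Rightarrow> 'a"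
  assumes "bounded_set smul A" "bounded_set smul B"
  shows "bounded_set smul (A \<union> B)"
  unfolding bounded_set_def
proof (intro allI impI)
  fix U :: "'a set" assume U: "0 \<in> interior U"
  from assms U obtain r s where "r > 0" "\<forall>c. norm c \<ge> r \<longrightarrow> A \<subseteq> smul c ` U"
    and "s > 0" "\<forall>c. norm c \<ge> s \<longrightarrow> B \<subseteq> smul c ` U"
    unfolding bounded_set_def absorbs_def by meson
  then show "absorbs smul U (A \<union> B)"
    unfolding absorbs_def by (intro exI[of _ "max r s"]) auto
qed

lemma bounded_set_empty: "bounded_set smul {}"
  unfolding bounded_set_def absorbs_def by (auto intro: exI[of _ 1])

lemma openin_strong_dual:
  "openin (strong_dual smul) W \<longleftrightarrow> W \<subseteq> dual smul \<and>
     (\<forall>f\<in>W. \<exists>B. bounded_set smul B \<and>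
        (\<exists>e>0. \<forall>g\<in>dual smul. (\<forall>x\<in>B. norm (g x - f x) \<le> e) \<longrightarrow> g \<in> W))"
proof -
  let ?N = "\<lambda>W f. \<exists>B. bounded_set smul B \<and>
        (\<exists>e>0. \<forall>g\<in>dual smul. (\<forall>x\<in>B. norm (g x - f x) \<le> e) \<longrightarrow> g \<in> W)"
  have int: "?N (V \<inter> W) f" if V: "?N V f" and W: "?N W f" for V W f
  proof -
    from V obtain A d where A: "bounded_set smul A" "d > 0"
      "\<forall>g\<in>dual smul. (\<forall>x\<in>A. norm (g x - f x) \<le> d) \<longrightarrow> g \<in> V" by blast
    from W obtain B e where B: "bounded_set smul B" "e > 0"
      "\<forall>g\<in>dual smul. (\<forall>x\<in>B. norm (g x - f x) \<le> e) \<longrightarrow> g \<in> W" by blast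
    have "\<forall>g\<in>dual smul. (\<forall>x\<in>A \<union> B. norm (g x - f x) \<le> min d e) \<longrightarrow> g \<in> V \<inter> W"
      using A(3) B(3) by simp
    moreover have "min d e > 0" using A(2) B(2) by simp
    ultimately show ?thesis using bounded_set_Un[OF A(1) B(1)] by blast
  qed
  have "istopology (\<lambda>W. W \<subseteq> dual smul \<and> (\<forall>f\<in>W. ?N W f))"
    unfolding istopology_def
  proof (intro conjI allI impI)
    fix V W assume "V \<subseteq> dual smul \<and> (\<forall>f\<in>V. ?N V f)" "W \<subseteq> dual smul \<and> (\<forall>f\<in>W. ?N W f)"
    then show "V \<inter> W \<subseteq> dual smul" "\<forall>f\<in>V \<inter> W. ?N (V \<inter> W) f"
      by (blast, intro ballI int) auto
  next
    fix K assume K: "\<forall>W\<in>K. W \<subseteq> dual smul \<and> (\<forall>f\<in>W. ?N W f)"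
    then show "\<Union>K \<subseteq> dual smul" by blast
    show "\<forall>f\<in>\<Union>K. ?N (\<Union>K) f"
    proof
      fix f assume "f \<in> \<Union>K"
      then obtain W where W: "W \<in> K" "f \<in> W" by blast
      then have "?N W f" using K by blast
      then show "?N (\<Union>K) f" using W(1) by (meson UnionI)
    qed
  qed
  then show ?thesis by (simp add: strong_dual_def topology_inverse')
qed

lemma topspace_strong_dual: "topspace (strong_dual smul) = dual smul"
proof -
  have "openin (strong_dual smul) (dual smul)"
    unfolding openin_strong_dual using bounded_set_empty[of smul]
    by (auto intro!: exI[of _ "{}"] exI[of _ 1])
  then show ?thesis
    by (metis openin_strong_dual openin_subset openin_topspace subset_antisym)
qed

text \<open>The dual of the strong dual; only the values of its members on the dual matter.\<close>

definition bidual ::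
    "(complex \<Rightarrow> 'a::{topological_space, ab_group_add} \<Rightarrow> 'a) \<Rightarrow> (('a \<Rightarrow> complex) \<Rightarrow> complex) set"
  where
  "bidual smul = {\<phi>.
     (\<forall>f\<in>dual smul. \<forall>g\<in>dual smul. \<phi> (\<lambda>x. f x + g x) = \<phi> f + \<phi> g) \<and>
     (\<forall>c. \<forall>f\<in>dual smul. \<phi> (\<lambda>x. c * f x) = c * \<phi> f) \<and>
     continuous_map (strong_dual smul) euclidean \<phi>}"

definition semi_reflexive ::
    "(complex \<Rightarrow> 'a::{topological_space, ab_group_add} \<Rightarrow> 'a) \<Rightarrow> bool" where
  "semi_reflexive smul \<longleftrightarrow> (\<forall>\<phi>\<in>bidual smul. \<exists>x. \<forall>f\<in>dual smul. \<phi> f = f x)"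

locale reflexive_locally_convex_hausdorff = locally_convex_hausdorff smul
  for smul :: "complex \<Rightarrow> 'a::{topological_ab_group_add, t2_space} \<Rightarrow> 'a" +
  assumes barrelled: "barrelled smul"
    and semi_reflexive: "semi_reflexive smul"

definition continuous_operator ::
    "(complex \<Rightarrow> 'a::{topological_space, ab_group_add} \<Rightarrow> 'a) \<Rightarrow> ('a \<Rightarrow> 'a) \<Rightarrow> bool" where
  "continuous_operator smul T \<longleftrightarrow> Vector_Spaces.linear smul smul T \<and> continuous_on UNIV T"

definition cesaro_mean ::
    "(complex \<Rightarrow> 'a::ab_group_add \<Rightarrow> 'a) \<Rightarrow> ('a \<Rightarrow> 'a) \<Rightarrow> nat \<Rightarrow> 'a \<Rightarrow> 'a" where
  "cesaro_mean smul T n x = smul (1 / of_nat (n + 1)) (\<Sum>k=0..n. (T ^^ k) x)"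

definition mean_ergodic ::
    "(complex \<Rightarrow> 'a::{topological_space, ab_group_add} \<Rightarrow> 'a) \<Rightarrow> ('a \<Rightarrow> 'a) \<Rightarrow> bool" where
  "mean_ergodic smul T \<longleftrightarrow>
     (\<exists>P. continuous_operator smul P \<and> (\<forall>x. (\<lambda>n. cesaro_mean smul T n x) \<longlonglongrightarrow> P x))"

definition power_sum :: "nat \<Rightarrow> real \<Rightarrow> real" where
  "power_sum n p = (\<Sum>i=1..n. real i powr p)"

text \<open>Rows and columns of the matrix are indexed from 1; row 0 is irrelevant in the limit.\<close>

definition M_matrix :: "real \<Rightarrow> nat \<Rightarrow> nat \<Rightarrow> real" where
  "M_matrix p n i = (if 1 \<le> i \<and> i \<le> n then real i powr p / power_sum n p else 0)"

definition M_mean ::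
    "(complex \<Rightarrow> 'a::ab_group_add \<Rightarrow> 'a) \<Rightarrow> real \<Rightarrow> ('a \<Rightarrow> 'a) \<Rightarrow> nat \<Rightarrow> 'a \<Rightarrow> 'a" where
  "M_mean smul p T n x = (\<Sum>i=1..n. smul (of_real (M_matrix p n i)) ((T ^^ (i - 1)) x))"

definition M_ergodic ::
    "(complex \<Rightarrow> 'a::{topological_space, ab_group_add} \<Rightarrow> 'a) \<Rightarrow> real \<Rightarrow> ('a \<Rightarrow> 'a) \<Rightarrow> bool" where
  "M_ergodic smul p T \<longleftrightarrow>
     (\<exists>P. continuous_operator smul P \<and> (\<forall>x. (\<lambda>n. M_mean smul p T n x) \<longlonglongrightarrow> P x))"

end

theory Submission
  imports Defs "HOL-Real_Asymp.Real_Asymp"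
begin

text \<open>
  The Cesaro means are the weighted means with weights \<open>i\<^sup>0\<close>, and the means defining
  \<open>M_p\<close>-ergodicity are the weighted means with weights \<open>i\<^sup>p\<close>. Everything therefore follows
  once these methods are seen to sum the same sequences of a locally convex space to the same
  limits whenever the exponents exceed \<open>-1\<close>; applied to each orbit of \<open>T\<close>, this shows that the
  same operator is the limit for all exponents.

  The comparison is a vector-valued form of a theorem of Hardy on weighted means
  (\<open>weighted_mean_inclusion\<close>). Summation by parts writes the means with weights \<open>b\<close> as a
  triangular matrix transform of the means with weights \<open>a\<close>. Its off-diagonal entries involve the
  increments of \<open>b / a\<close>; if \<open>b / a\<close> is monotone, those in one row all have the same
  sign, and since each row adds up to 1, its absolute sum is controlled by the diagonal
  entry alone. A bound on the diagonal entries together with the divergence of the sums of \<open>b\<close>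
  then makes the matrix regular in the sense of Toeplitz.

  Such a matrix preserves limits in every locally convex space (\<open>matrix_transform_null\<close>): a row
  of bounded absolute sum applied to elements of a small symmetric convex neighbourhood of 0 gives
  a bounded multiple of an absolutely convex combination. For power weights, the diagonal
  entries are bounded because \<open>1\<^sup>p + \<dots> + n\<^sup>p\<close> lies between positive multiples of
  \<open>n\<^sup>p\<^sup>+\<^sup>1\<close> when \<open>p > -1\<close>.
\<close>

section \<open>Null sequences under matrix transforms\<close>

context locally_convex_hausdorff
begin

text \<open>The matrices have real entries of both signs; viewing the space as a real vector space makes
  the algebra of such coefficients available without coercions.\<close>
definition real_scale :: "real \<Rightarrow> 'a \<Rightarrow> 'a"  (infixr "\<cdot>" 75) where
  "r \<cdot> x = smul (of_real r) x"

sublocale real: vector_space real_scale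
  by unfold_locales (simp_all add: real_scale_def scale_right_distrib scale_left_distrib)

lemma tendsto_real_scale:
  assumes "(f \<longlongrightarrow> c) F" "(g \<longlongrightarrow> x) F"
  shows "((\<lambda>n. f n \<cdot> g n) \<longlongrightarrow> c \<cdot> x) F"
proof -
  have "((\<lambda>n. (complex_of_real (f n), g n)) \<longlongrightarrow> (complex_of_real c, x)) F"
    using assms by (intro tendsto_intros)
  moreover have "isCont (\<lambda>(c, x). smul c x) (complex_of_real c, x)"
    using continuous_scale by (simp add: continuous_on_eq_continuous_at)
  ultimately show ?thesis
    using isCont_tendsto_compose by (fastforce simp: real_scale_def)
qed

text \<open>Intersecting a convex neighbourhood \<open>V\<close> with \<open>- V\<close> provides the symmetry that negative
  coefficients require.\<close>
lemma symmetric_convex_neighbourhood: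
  assumes "open U" "0 \<in> U"
  obtains W where "W \<subseteq> U" "0 \<in> interior W" "convex_set smul W" "\<And>x. x \<in> W \<Longrightarrow> - x \<in> W"
proof -
  obtain V where V: "V \<subseteq> U" "0 \<in> interior V" "convex_set smul V"
    using locally_convex[of U] assms by (auto simp: interior_open)
  define W where "W = V \<inter> uminus -` V"
  show thesis
  proof
    show "W \<subseteq> U" using V(1) by (auto simp: W_def)
    have "open (uminus -` interior V)"
      by (intro open_vimage continuous_intros) auto
    then have "open (interior V \<inter> uminus -` interior V)" by blast
    moreover have "interior V \<inter> uminus -` interior V \<subseteq> W"
      using interior_subset[of V] by (auto simp: W_def)
    ultimately show "0 \<in> interior W"
      using V(2) by (intro interiorI) auto
    show "convex_set smul W"
      unfolding convex_set_def
    proof (intro ballI allI impI)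
      fix x y and u v :: real
      assume *: "x \<in> W" "y \<in> W" "u \<ge> 0" "v \<ge> 0" "u + v = 1"
      then have "smul (of_real u) x + smul (of_real v) y \<in> V"
        using V(3) by (auto simp: convex_set_def W_def)
      moreover have "smul (of_real u) (- x) + smul (of_real v) (- y) \<in> V"
        using * V(3) unfolding convex_set_def W_def by blast
      ultimately show "smul (of_real u) x + smul (of_real v) y \<in> W"
        by (simp add: W_def add.commute)
    qed
    show "- x \<in> W" if "x \<in> W" for x using that by (auto simp: W_def)
  qed
qed

text \<open>The induction works with the homogeneous form of the claim, that the combination lies in the
  multiple \<open>(\<Sum>i\<in>I. \<bar>c i\<bar>) W\<close>, so that
  it applies to the subfamilies met on the way whatever their total coefficient is.\<close>
lemma absolutely_convex_combination_mem:
  fixes c :: "'i \<Rightarrow> real"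
  assumes W: "convex_set smul W" "0 \<in> W" "\<And>x. x \<in> W \<Longrightarrow> - x \<in> W"
    and I: "finite I" "\<And>i. i \<in> I \<Longrightarrow> w i \<in> W" and le1: "(\<Sum>i\<in>I. \<bar>c i\<bar>) \<le> 1"
  shows "(\<Sum>i\<in>I. c i \<cdot> w i) \<in> W"
proof -
  have comb: "u \<cdot> x + v \<cdot> y \<in> W" if "x \<in> W" "y \<in> W" "u \<ge> 0" "v \<ge> 0" "u + v = 1" for x y u v
    using that W(1) by (auto simp: convex_set_def real_scale_def)
  have "\<exists>x\<in>W. (\<Sum>i\<in>I. c i \<cdot> w i) = (\<Sum>i\<in>I. \<bar>c i\<bar>) \<cdot> x"
    using I
  proof (induction I rule: finite_induct)
    case empty
    then show ?case using W(2) by auto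
  next
    case (insert j I)
    then obtain x where x: "x \<in> W" "(\<Sum>i\<in>I. c i \<cdot> w i) = (\<Sum>i\<in>I. \<bar>c i\<bar>) \<cdot> x" by auto
    define s where "s = (\<Sum>i\<in>I. \<bar>c i\<bar>)"
    define t where "t = s + \<bar>c j\<bar>"
    have s: "s \<ge> 0" by (simp add: s_def sum_nonneg)
    obtain y where y: "y \<in> W" "c j \<cdot> w j = \<bar>c j\<bar> \<cdot> y"
    proof (cases "c j \<ge> 0")
      case True
      then show thesis using that[of "w j"] insert.prems by simp
    next
      case False
      then show thesis using that[of "- w j"] insert.prems W(3) by simp
    qed
    have sum: "(\<Sum>i\<in>insert j I. c i \<cdot> w i) = s \<cdot> x + \<bar>c j\<bar> \<cdot> y"
      using insert.hyps x(2) y(2) by (simp add: s_def add.commute)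
    have t: "(\<Sum>i\<in>insert j I. \<bar>c i\<bar>) = t"
      using insert.hyps by (simp add: t_def s_def)
    show ?case
    proof (cases "t = 0")
      case True
      then have "s = 0" "c j = 0" using s by (auto simp: t_def)
      then show ?thesis using sum t True W(2) by auto
    next
      case False
      then have "t > 0" using s by (auto simp: t_def)
      then have "(s / t) \<cdot> x + (\<bar>c j\<bar> / t) \<cdot> y \<in> W"
        using s by (intro comb x(1) y(1)) (auto simp: t_def add_divide_distrib[symmetric])
      moreover have "s \<cdot> x + \<bar>c j\<bar> \<cdot> y = t \<cdot> ((s / t) \<cdot> x + (\<bar>c j\<bar> / t) \<cdot> y)"
        using \<open>t > 0\<close> by (simp add: real.scale_right_distrib)
      ultimately show ?thesis using sum t by metis
    qed
  qed
  then obtain x where x: "x \<in> W" "(\<Sum>i\<in>I. c i \<cdot> w i) = (\<Sum>i\<in>I. \<bar>c i\<bar>) \<cdot> x" by blast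
  \<comment> \<open>Coefficients of total less than 1 are filled up with the point 0.\<close>
  have "(\<Sum>i\<in>I. \<bar>c i\<bar>) \<cdot> x + (1 - (\<Sum>i\<in>I. \<bar>c i\<bar>)) \<cdot> 0 \<in> W"
    using le1 by (intro comb x(1) W(2)) (auto intro: sum_nonneg)
  then show ?thesis using x(2) by simp
qed

text \<open>The sum splits at an index beyond which \<open>z\<close> is small. The finitely many earlier terms
  vanish in the limit because every column does; the later ones are controlled by the
  bound \<open>K\<close> on the rows.\<close>
lemma matrix_transform_null:
  fixes a :: "nat \<Rightarrow> nat \<Rightarrow> real"
  assumes z: "z \<longlonglongrightarrow> 0" and columns: "\<And>i. (\<lambda>n. a n i) \<longlonglongrightarrow> 0"
    and rows: "\<And>n. (\<Sum>i=1..n. \<bar>a n i\<bar>) \<le> K"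
  shows "(\<lambda>n. \<Sum>i=1..n. a n i \<cdot> z i) \<longlonglongrightarrow> 0"
proof (rule topological_tendstoI)
  fix U :: "'a set" assume U: "open U" "0 \<in> U"
  obtain W where W: "W \<subseteq> U" "0 \<in> interior W" "convex_set smul W" "\<And>x. x \<in> W \<Longrightarrow> - x \<in> W"
    using symmetric_convex_neighbourhood[OF U] by metis
  have W0: "0 \<in> W" using W(2) interior_subset by blast
  have ev: "eventually (\<lambda>n. f n \<in> W) sequentially" if "f \<longlonglongrightarrow> 0" for f :: "nat \<Rightarrow> 'a"
    using topological_tendstoD[OF that open_interior W(2)] interior_subset[of W]
    by (auto elim: eventually_mono)
  have K: "K \<ge> 0" using rows[of 0] by simp
  define L where "L = 2 * (K + 1)"
  have L: "L > 0" using K by (simp add: L_def)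
  have "(\<lambda>i. L \<cdot> z i) \<longlonglongrightarrow> L \<cdot> 0" by (intro tendsto_real_scale tendsto_const z)
  then have "eventually (\<lambda>i. L \<cdot> z i \<in> W) sequentially" by (intro ev) simp
  then obtain N where N: "\<And>i. i \<ge> N \<Longrightarrow> L \<cdot> z i \<in> W"
    by (auto simp: eventually_sequentially)
  have "(\<lambda>n. 2 \<cdot> (\<Sum>i=1..N. a n i \<cdot> z i)) \<longlonglongrightarrow> 2 \<cdot> (\<Sum>i=1..N. 0 \<cdot> z i)"
    by (intro tendsto_real_scale tendsto_sum columns tendsto_const)
  then have "eventually (\<lambda>n. 2 \<cdot> (\<Sum>i=1..N. a n i \<cdot> z i) \<in> W) sequentially"
    by (intro ev) simp
  then show "eventually (\<lambda>n. (\<Sum>i=1..n. a n i \<cdot> z i) \<in> U) sequentially"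
    using eventually_ge_at_top[of N]
  proof eventually_elim
    case (elim n)
    \<comment> \<open>The initial part of the sum enters as one point \<open>w 0\<close> with coefficient \<open>1 / 2\<close>; the choice of
      \<open>L\<close> leaves at most the other half for the coefficients of the tail.\<close>
    define c where "c i = (if i = 0 then 1 / 2 else a n i / L)" for i
    define w where "w i = (if i = 0 then 2 \<cdot> (\<Sum>i=1..N. a n i \<cdot> z i) else L \<cdot> z i)" for i
    have "(\<Sum>i=Suc N..n. \<bar>a n i\<bar>) \<le> (\<Sum>i=1..n. \<bar>a n i\<bar>)"
      by (rule sum_mono2) auto
    also have "\<dots> \<le> K" by (rule rows)
    finally have "(\<Sum>i=Suc N..n. \<bar>a n i\<bar>) / L \<le> 1 / 2"
      using L by (simp add: L_def field_simps)
    moreover have "(\<Sum>i=Suc N..n. \<bar>c i\<bar>) = (\<Sum>i=Suc N..n. \<bar>a n i\<bar>) / L"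
      unfolding sum_divide_distrib using L by (intro sum.cong) (auto simp: c_def)
    ultimately have "(\<Sum>i\<in>insert 0 {Suc N..n}. \<bar>c i\<bar>) \<le> 1"
      by (simp add: c_def[of 0] field_simps)
    then have "(\<Sum>i\<in>insert 0 {Suc N..n}. c i \<cdot> w i) \<in> W"
      using elim N by (intro absolutely_convex_combination_mem W W0) (auto simp: w_def)
    moreover have "(\<Sum>i=Suc N..n. c i \<cdot> w i) = (\<Sum>i=Suc N..n. a n i \<cdot> z i)"
      using L by (intro sum.cong) (auto simp: c_def w_def)
    moreover have "c 0 \<cdot> w 0 = (\<Sum>i=1..N. a n i \<cdot> z i)" by (simp add: c_def w_def)
    moreover have "(\<Sum>i=1..n. a n i \<cdot> z i)
        = (\<Sum>i=1..N. a n i \<cdot> z i) + (\<Sum>i=Suc N..n. a n i \<cdot> z i)"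
      using elim(2) by (subst sum.union_disjoint[symmetric]) (auto intro!: sum.cong)
    ultimately show ?case using W(1) by auto
  qed
qed

end

section \<open>Comparison of weighted means\<close>

lemma (in module) summation_by_parts:
  "(\<Sum>i=1..Suc n. scale (f i) (v i))
     = (\<Sum>i=1..n. scale (f i - f (Suc i)) (\<Sum>j=1..i. v j)) + scale (f (Suc n)) (\<Sum>j=1..Suc n. v j)"
  by (induction n) (simp_all add: scale_left_diff_distrib scale_right_distrib algebra_simps)

context locally_convex_hausdorff
begin

definition weighted_mean :: "(nat \<Rightarrow> real) \<Rightarrow> (nat \<Rightarrow> 'a) \<Rightarrow> nat \<Rightarrow> 'a" where
  "weighted_mean w x n = (\<Sum>i=1..n. (w i / (\<Sum>j=1..n. w j)) \<cdot> x i)"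

lemma weighted_sum_eq_mean:
  assumes "\<And>i. i \<ge> 1 \<Longrightarrow> w i > 0"
  shows "(\<Sum>i=1..n. w i \<cdot> x i) = (\<Sum>j=1..n. w j) \<cdot> weighted_mean w x n"
proof (cases "n = 0")
  case False
  then have "(\<Sum>j=1..n. w j) > 0" using assms by (intro sum_pos) auto
  then show ?thesis
    unfolding weighted_mean_def real.scale_sum_right by (intro sum.cong) auto
qed (simp add: weighted_mean_def)

text \<open>
  With \<open>f = b / a\<close> and \<open>t\<close> the means for \<open>a\<close>, the partial sums of \<open>a i \<cdot> x i\<close> are \<open>A i \<cdot> t i\<close>, so
  summation by parts applied to \<open>b i \<cdot> x i = f i \<cdot> (a i \<cdot> x i)\<close> expresses the means for \<open>b\<close>
  through \<open>t\<close>. The hypothesis \<open>bound\<close> is exactly the boundedness of the diagonal of the resulting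
  matrix, and \<open>monotone\<close> says that each of its rows has off-diagonal entries of one sign.
\<close>
theorem weighted_mean_inclusion:
  fixes a b :: "nat \<Rightarrow> real" and x :: "nat \<Rightarrow> 'a"
  defines "A \<equiv> \<lambda>n. \<Sum>i=1..n. a i" and "B \<equiv> \<lambda>n. \<Sum>i=1..n. b i"
  assumes a: "\<And>i. i \<ge> 1 \<Longrightarrow> a i > 0" and b: "\<And>i. i \<ge> 1 \<Longrightarrow> b i > 0"
    and B_top: "filterlim B at_top sequentially"
    and monotone: "(\<forall>i\<ge>1. b i / a i \<le> b (Suc i) / a (Suc i)) \<or>
                   (\<forall>i\<ge>1. b (Suc i) / a (Suc i) \<le> b i / a i)"
    and bound: "\<And>n. n \<ge> 1 \<Longrightarrow> b n / a n * A n \<le> C * B n"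
    and lim: "weighted_mean a x \<longlonglongrightarrow> l"
  shows "weighted_mean b x \<longlonglongrightarrow> l"
proof -
  define f where "f i = b i / a i" for i
  define t where "t = weighted_mean a x"
  define c where "c n i = (if i = n then f n * A n else (f i - f (Suc i)) * A i) / B n" for n i
  have A: "A n \<ge> 0" for n using a unfolding A_def by (intro sum_nonneg) (auto intro: less_imp_le)
  have B: "B n > 0" if "n \<ge> 1" for n using that b unfolding B_def by (intro sum_pos) auto
  have f: "f i * a i = b i" "f i > 0" if "i \<ge> 1" for i
    using a[OF that] b[OF that] by (auto simp: f_def)
  have partial_sum: "(\<Sum>i=1..n. a i \<cdot> x i) = A n \<cdot> t n" for n
    unfolding A_def t_def by (rule weighted_sum_eq_mean[of a, OF a])
  have transform: "weighted_mean b x n = (\<Sum>i=1..n. c n i \<cdot> t i)" if "n \<ge> 1" for n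
  proof -
    obtain m where m: "n = Suc m" using \<open>n \<ge> 1\<close> by (cases n) auto
    have "B n \<cdot> weighted_mean b x n = (\<Sum>i=1..Suc m. b i \<cdot> x i)"
      unfolding B_def m by (rule weighted_sum_eq_mean[of b, OF b, symmetric])
    also have "\<dots> = (\<Sum>i=1..Suc m. f i \<cdot> (a i \<cdot> x i))"
      using f(1) by (intro sum.cong) auto
    also have "\<dots> = (\<Sum>i=1..m. (f i - f (Suc i)) \<cdot> A i \<cdot> t i) + f n \<cdot> A n \<cdot> t n"
      unfolding real.summation_by_parts[of f "\<lambda>i. a i \<cdot> x i" m] partial_sum m by simp
    also have "\<dots> = (\<Sum>i=1..n. (B n * c n i) \<cdot> t i)"
      using B[OF that] by (auto simp: c_def m intro!: sum.cong)
    also have "\<dots> = B n \<cdot> (\<Sum>i=1..n. c n i \<cdot> t i)"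
      by (simp add: real.scale_sum_right)
    finally show ?thesis using B[OF that] by simp
  qed
  \<comment> \<open>The same computation for the constant sequence 1, all of whose means are 1.\<close>
  have row_sum: "(\<Sum>i=1..n. c n i) = 1" if "n \<ge> 1" for n
  proof -
    obtain m where m: "n = Suc m" using \<open>n \<ge> 1\<close> by (cases n) auto
    have "B n = (\<Sum>i=1..Suc m. f i * a i)"
      unfolding B_def m using f(1) by (intro sum.cong) auto
    also have "\<dots> = (\<Sum>i=1..m. (f i - f (Suc i)) * A i) + f n * A n"
      unfolding vector_space_over_itself.summation_by_parts by (simp add: A_def m)
    also have "\<dots> = (\<Sum>i=1..n. B n * c n i)"
      using B[OF that] by (auto simp: c_def m intro!: sum.cong)
    also have "\<dots> = B n * (\<Sum>i=1..n. c n i)" by (simp add: sum_distrib_left)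
    finally show ?thesis using B[OF that] by simp
  qed
  have diagonal: "0 \<le> c n n" "c n n \<le> C" if "n \<ge> 1" for n
    using bound[OF that, folded f_def] A[of n] B[OF that] f(2)[OF that]
    by (simp_all add: c_def pos_divide_le_eq)
  have row_abs: "(\<Sum>i=1..n. \<bar>c n i\<bar>) \<le> 1 + 2 * \<bar>C\<bar>" for n
  proof (cases n)
    case (Suc m)
    have sign: "(\<forall>i\<in>{1..m}. 0 \<le> c n i) \<or> (\<forall>i\<in>{1..m}. c n i \<le> 0)"
      using monotone[folded f_def] A B[of n] Suc
      by (auto simp: c_def mult_nonneg_nonneg mult_nonpos_nonneg divide_nonneg_pos divide_nonpos_pos)
    then have "(\<Sum>i=1..m. \<bar>c n i\<bar>) = \<bar>\<Sum>i=1..m. c n i\<bar>"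
    proof
      assume "\<forall>i\<in>{1..m}. c n i \<le> 0"
      moreover from this have "(\<Sum>i=1..m. c n i) \<le> 0" by (intro sum_nonpos) auto
      ultimately show ?thesis by (auto simp: sum_negf[symmetric] intro!: sum.cong)
    next
      assume "\<forall>i\<in>{1..m}. 0 \<le> c n i"
      moreover from this have "0 \<le> (\<Sum>i=1..m. c n i)" by (intro sum_nonneg) auto
      ultimately show ?thesis by (auto intro!: sum.cong)
    qed
    also have "(\<Sum>i=1..m. c n i) = 1 - c n n" using row_sum[of n] Suc by simp
    finally show ?thesis using diagonal[of n] Suc by simp
  qed simp
  have columns: "(\<lambda>n. c n i) \<longlonglongrightarrow> 0" for i
  proof -
    have "(\<lambda>n. (f i - f (Suc i)) * A i / B n) \<longlonglongrightarrow> 0"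
      by (rule real_tendsto_divide_at_top[OF tendsto_const B_top])
    then show ?thesis
      by (rule Lim_transform_eventually)
         (use eventually_gt_at_top[of i] in eventually_elim, simp add: c_def)
  qed
  have "(\<lambda>i. t i - l) \<longlonglongrightarrow> l - l"
    using lim unfolding t_def by (intro tendsto_intros) auto
  then have "(\<lambda>n. \<Sum>i=1..n. c n i \<cdot> (t i - l)) \<longlonglongrightarrow> 0"
    by (intro matrix_transform_null[OF _ columns row_abs]) simp
  then have "(\<lambda>n. (\<Sum>i=1..n. c n i \<cdot> (t i - l)) + l) \<longlonglongrightarrow> 0 + l"
    by (intro tendsto_intros)
  moreover have "(\<Sum>i=1..n. c n i \<cdot> (t i - l)) + l = weighted_mean b x n" if "n \<ge> 1" for n
    using transform[OF that] row_sum[OF that]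
    by (simp add: real.scale_right_diff_distrib sum_subtractf real.scale_sum_left[symmetric])
  ultimately show ?thesis
    using Lim_transform_eventually eventually_ge_at_top[of "1::nat"]
    by (smt (verit) add_0 eventually_mono)
qed

end

section \<open>Power weights\<close>

text \<open>Consecutive differences of \<open>x\<^sup>p\<^sup>+\<^sup>1\<close> are comparable to \<open>(p + 1) i\<^sup>p\<close>, on a side depending on
  the sign of \<open>p\<close>. This gives one of the two estimates of the power sum by telescoping; the other
  compares each term with \<open>n\<^sup>p\<close>. The case \<open>i = 1\<close>, where the interval starts at 0, is what
  needs \<open>p > -1\<close>.\<close>
lemma powr_increment:
  fixes p :: real
  assumes "p > -1" "i \<ge> (1::nat)"
  obtains \<xi> where "real i - 1 < \<xi>" "\<xi> < real i"
    "real i powr (p + 1) - (real i - 1) powr (p + 1) = (p + 1) * \<xi> powr p"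
proof -
  have deriv: "((\<lambda>x. x powr (p + 1)) has_real_derivative (p + 1) * x powr p) (at x)"
    if "real i - 1 < x" for x
    using that assms by (auto intro!: derivative_eq_intros)
  have "\<exists>l z. real i - 1 < z \<and> z < real i \<and> ((\<lambda>x. x powr (p + 1)) has_real_derivative l) (at z) \<and>
      real i powr (p + 1) - (real i - 1) powr (p + 1) = (real i - (real i - 1)) * l"
  proof (rule MVT)
    show "continuous_on {real i - 1..real i} (\<lambda>x. x powr (p + 1))"
      using assms by (intro continuous_on_powr' continuous_intros) auto
  qed (use deriv real_differentiable_def in auto)
  then obtain l z where z: "real i - 1 < z" "z < real i"
    "((\<lambda>x. x powr (p + 1)) has_real_derivative l) (at z)"
    "real i powr (p + 1) - (real i - 1) powr (p + 1) = (real i - (real i - 1)) * l" by blast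
  have "l = (p + 1) * z powr p" using DERIV_unique[OF z(3) deriv[OF z(1)]] .
  then show thesis using that[OF z(1,2)] z(4) by simp
qed

lemma sum_powr_increments:
  assumes "p > -1"
  shows "(\<Sum>i=1..n. real i powr (p + 1) - (real i - 1) powr (p + 1)) = real n powr (p + 1)"
  using assms by (induction n) auto

lemma power_sum_upper:
  assumes "p > -1"
  shows "power_sum n p \<le> max 1 (1 / (p + 1)) * real n powr (p + 1)"
proof (cases "p \<ge> 0")
  case True
  have "power_sum n p \<le> (\<Sum>i=1..n. real n powr p)"
    unfolding power_sum_def using True by (intro sum_mono powr_mono2) auto
  also have "\<dots> = 1 * real n powr (p + 1)" by (cases "n = 0") (simp_all add: powr_add)
  also have "\<dots> \<le> max 1 (1 / (p + 1)) * real n powr (p + 1)" by (intro mult_right_mono) auto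
  finally show ?thesis .
next
  case False
  have "real i powr p \<le> 1 / (p + 1) * (real i powr (p + 1) - (real i - 1) powr (p + 1))"
    if "i \<ge> 1" for i
  proof -
    obtain \<xi> where "real i - 1 < \<xi>" "\<xi> < real i"
      "real i powr (p + 1) - (real i - 1) powr (p + 1) = (p + 1) * \<xi> powr p"
      using powr_increment[OF assms \<open>i \<ge> 1\<close>] .
    then show ?thesis using False assms that by (auto intro: powr_mono2')
  qed
  then have "power_sum n p
      \<le> (\<Sum>i=1..n. 1 / (p + 1) * (real i powr (p + 1) - (real i - 1) powr (p + 1)))"
    unfolding power_sum_def by (intro sum_mono) auto
  also have "\<dots> = 1 / (p + 1) * real n powr (p + 1)"
    by (simp only: sum_distrib_left[symmetric] sum_powr_increments[OF assms])
  also have "\<dots> \<le> max 1 (1 / (p + 1)) * real n powr (p + 1)" by (intro mult_right_mono) auto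
  finally show ?thesis .
qed

lemma power_sum_lower:
  assumes "p > -1"
  shows "min 1 (1 / (p + 1)) * real n powr (p + 1) \<le> power_sum n p"
proof (cases "p \<ge> 0")
  case False
  have "min 1 (1 / (p + 1)) * real n powr (p + 1) \<le> 1 * real n powr (p + 1)"
    by (intro mult_right_mono) auto
  also have "\<dots> = (\<Sum>i=1..n. real n powr p)" by (cases "n = 0") (simp_all add: powr_add)
  also have "\<dots> \<le> power_sum n p"
    unfolding power_sum_def using False by (intro sum_mono powr_mono2') auto
  finally show ?thesis .
next
  case True
  have "1 / (p + 1) * (real i powr (p + 1) - (real i - 1) powr (p + 1)) \<le> real i powr p"
    if "i \<ge> 1" for i
  proof -
    obtain \<xi> where "real i - 1 < \<xi>" "\<xi> < real i"
      "real i powr (p + 1) - (real i - 1) powr (p + 1) = (p + 1) * \<xi> powr p"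
      using powr_increment[OF assms \<open>i \<ge> 1\<close>] .
    then show ?thesis using True that by (auto intro: powr_mono2)
  qed
  then have "(\<Sum>i=1..n. 1 / (p + 1) * (real i powr (p + 1) - (real i - 1) powr (p + 1)))
      \<le> power_sum n p"
    unfolding power_sum_def by (intro sum_mono) auto
  moreover have "(\<Sum>i=1..n. 1 / (p + 1) * (real i powr (p + 1) - (real i - 1) powr (p + 1)))
      = 1 / (p + 1) * real n powr (p + 1)"
    by (simp only: sum_distrib_left[symmetric] sum_powr_increments[OF assms])
  moreover have "min 1 (1 / (p + 1)) * real n powr (p + 1) \<le> 1 / (p + 1) * real n powr (p + 1)"
    by (intro mult_right_mono) auto
  ultimately show ?thesis by linarith
qed

lemma power_sum_at_top:
  assumes "p > -1"
  shows "filterlim (\<lambda>n. power_sum n p) at_top sequentially"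
proof (rule filterlim_at_top_mono)
  have "filterlim (\<lambda>n. real n powr (p + 1)) at_top sequentially"
    using assms by real_asymp
  then show "filterlim (\<lambda>n. min 1 (1 / (p + 1)) * real n powr (p + 1)) at_top sequentially"
    using assms by (intro filterlim_tendsto_pos_mult_at_top[OF tendsto_const]) auto
qed (use power_sum_lower[OF assms] in auto)

text \<open>This is the diagonal bound demanded by the comparison of weighted means: both sides are of
  order \<open>n\<^sup>q\<^sup>+\<^sup>1\<close>.\<close>
lemma power_sum_comparison:
  assumes "p > -1" "q > -1"
  obtains C where "\<And>n. n \<ge> 1 \<Longrightarrow> real n powr q / real n powr p * power_sum n p \<le> C * power_sum n q"
proof
  fix n :: nat assume n: "n \<ge> 1"
  have "real n powr q / real n powr p * power_sum n p
      \<le> real n powr q / real n powr p * (max 1 (1 / (p + 1)) * real n powr (p + 1))"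
    by (intro mult_left_mono power_sum_upper assms) auto
  also have "\<dots> = max 1 (1 / (p + 1)) * real n powr (q + 1)"
    using n by (simp add: powr_add)
  also have "\<dots> \<le> max 1 (1 / (p + 1)) * (power_sum n q / min 1 (1 / (q + 1)))"
    using power_sum_lower[OF assms(2), of n] assms
    by (intro mult_left_mono) (auto simp: pos_le_divide_eq mult.commute)
  finally show "real n powr q / real n powr p * power_sum n p
      \<le> (max 1 (1 / (p + 1)) / min 1 (1 / (q + 1))) * power_sum n q" by simp
qed

section \<open>Ergodicity\<close>

context locally_convex_hausdorff
begin

lemma M_mean_eq_weighted_mean:
  "M_mean smul p T n x = weighted_mean (\<lambda>i. real i powr p) (\<lambda>i. (T ^^ (i - 1)) x) n"
  unfolding M_mean_def weighted_mean_def M_matrix_def power_sum_def real_scale_def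
  by (intro sum.cong) auto

text \<open>The quotient of the weights is \<open>i\<^sup>q\<^sup>-\<^sup>p\<close>, increasing or decreasing according to the sign of
  \<open>q - p\<close>.\<close>
lemma M_mean_limit_transfer:
  assumes "p > -1" "q > -1" and lim: "(\<lambda>n. M_mean smul p T n x) \<longlonglongrightarrow> l"
  shows "(\<lambda>n. M_mean smul q T n x) \<longlonglongrightarrow> l"
proof -
  obtain C where C:
    "\<And>n. n \<ge> 1 \<Longrightarrow> real n powr q / real n powr p * power_sum n p \<le> C * power_sum n q"
    using power_sum_comparison[OF assms(1,2)] by metis
  have "(\<forall>i\<ge>1. real i powr q / real i powr p \<le> real (Suc i) powr q / real (Suc i) powr p) \<or>
        (\<forall>i\<ge>1. real (Suc i) powr q / real (Suc i) powr p \<le> real i powr q / real i powr p)"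
  proof (cases "q \<ge> p")
    case True
    then show ?thesis unfolding powr_diff[symmetric] by (intro disjI1 allI impI powr_mono2) auto
  next
    case False
    then show ?thesis unfolding powr_diff[symmetric] by (intro disjI2 allI impI powr_mono2') auto
  qed
  then show ?thesis
    using lim C power_sum_at_top[OF assms(2)] unfolding M_mean_eq_weighted_mean power_sum_def
    by (intro weighted_mean_inclusion[of "\<lambda>i. real i powr p" "\<lambda>i. real i powr q"]) auto
qed

lemma M_ergodic_transfer:
  "p > -1 \<Longrightarrow> q > -1 \<Longrightarrow> M_ergodic smul p T \<Longrightarrow> M_ergodic smul q T"
  unfolding M_ergodic_def using M_mean_limit_transfer by blast

lemma cesaro_mean_eq_M_mean: "cesaro_mean smul T n x = M_mean smul 0 T (Suc n) x"
proof -
  have "M_mean smul 0 T (Suc n) x = (\<Sum>i=Suc 0..Suc n. smul (1 / of_nat (n + 1)) ((T ^^ (i - 1)) x))"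
    unfolding M_mean_def M_matrix_def power_sum_def by (intro sum.cong) auto
  then show ?thesis
    unfolding sum.shift_bounds_cl_Suc_ivl by (simp add: cesaro_mean_def scale_sum_right)
qed

lemma mean_ergodic_iff_M_ergodic_0: "mean_ergodic smul T \<longleftrightarrow> M_ergodic smul 0 T"
  unfolding mean_ergodic_def M_ergodic_def cesaro_mean_eq_M_mean
  by (simp add: filterlim_sequentially_Suc[of "\<lambda>n. M_mean smul 0 T n _"])

end

theorem theorem5p10:
  fixes smul :: "complex \<Rightarrow> 'a::{topological_ab_group_add, t2_space} \<Rightarrow> 'a"
    and T :: "'a \<Rightarrow> 'a"
  assumes "reflexive_locally_convex_hausdorff smul"
    and "continuous_operator smul T"
  shows "(mean_ergodic smul T \<longleftrightarrow> (\<exists>p>-1. M_ergodic smul p T)) \<and>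
         ((\<exists>p>-1. M_ergodic smul p T) \<longleftrightarrow> (\<forall>p>-1. M_ergodic smul p T))"
proof -
  interpret locally_convex_hausdorff smul
    using assms(1) by (rule reflexive_locally_convex_hausdorff.axioms(1))
  have "(0::real) > -1" by simp
  then show ?thesis
    unfolding mean_ergodic_iff_M_ergodic_0 using M_ergodic_transfer by blast
qed

end
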